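(* Let $\alpha\in\{-1,1\}$ and let $W_\alpha(M,\mathbf X)$ and $W_\alpha(N,\mathbf E)$ be CCR random variables (see context), with $\mathbf X=(X_1,X_2,\dots)$, $\mathbf E=(E_1,E_2,\dots)$, $M$ and $N$ defined on the same probability space. Then for all $h\in\mathrm{Lip}_b(1)$, $$\left|\mathbb E h(W_\alpha(N,\mathbf E))-\mathbb E h(W_\alpha(M,\mathbf X))\right|\le\|h'\|\sum_{i=1}^\infty\mathbb E|E_i-X_i|\,\mathbb P(M\ge i)+\sum_{m,n=1}^\infty\mathbb P(M=m,N=n)\left|\mathbb E h(W_\alpha(n,\mathbf E))-\mathbb E h(W_\alpha(m,\mathbf E))\right|.$$ If $M$ and $N$ are identically distributed, then $$\left|\mathbb E h(W_\alpha(N,\mathbf E))-\mathbb E h(W_\alpha(N,\mathbf X))\right|\le\|h'\|\sum_{i=1}^\infty\mathbb E|E_i-X_i|\,\mathbb P(N\ge i).$$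
   Context: $\mathbb N=\{1,2,\dots\}$. CCR random variables: let $N$ be an $\mathbb N$-valued random variable with finite second moment and $\mathbf E=(E_1,E_2,\dots)$ positive i.i.d. random variables independent of $N$. For $\alpha\in\{-1,1\}$, $W_\alpha(N,\mathbf E)=\min\{E_1,\dots,E_N\}$ if $\alpha=-1$ and $W_\alpha(N,\mathbf E)=\max\{E_1,\dots,E_N\}$ if $\alpha=1$; for a deterministic $n\in\mathbb N$, $W_\alpha(n,\mathbf E)$ is the same with $N$ replaced by $n$. Analogously for $(M,\mathbf X)$. The random numbers $M$ and $N$ are each independent of the pair of sequences $(\mathbf E,\mathbf X)$; the coupling between $\mathbf E$ and $\mathbf X$ and that between $M$ and $N$ are arbitrary. $\mathrm{Lip}_b(1)=\{h:(0,\infty)\to\mathbb R:\ |h(x)-h(y)|\le|x-y|\text{ for all }x,y;\ \|h\|\le1\}$, where $\|\cdot\|$ is the supremum norm; $h'$ is the almost everywhere existing derivative of $h$ and $\|h'\|$ its (essential) supremum. *)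

theory Defs
  imports "HOL-Probability.Probability"
begin

text \<open>Independence of two random variables whose value spaces may have different types; the
  constant \<open>prob_space.indep_var\<close> requires both to have the same type.\<close>

definition indep_rv ::
  "'a measure \<Rightarrow> 'b measure \<Rightarrow> ('a \<Rightarrow> 'b) \<Rightarrow> 'c measure \<Rightarrow> ('a \<Rightarrow> 'c) \<Rightarrow> bool" where
  "indep_rv P S U T V \<longleftrightarrow>
     U \<in> measurable P S \<and> V \<in> measurable P T \<and>
     prob_space.indep_set P
       {U -` A \<inter> space P | A. A \<in> sets S} {V -` B \<inter> space P | B. B \<in> sets T}"

text \<open>Sequences are indexed by the positive integers: a sequence is a function on \<open>nat\<close> whose
  value at \<open>0\<close> is never used.\<close>

definition seq_space :: "(nat \<Rightarrow> real) measure" where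
  "seq_space = (\<Pi>\<^sub>M i\<in>{1..}. borel)"

definition rseq :: "(nat \<Rightarrow> 'a \<Rightarrow> real) \<Rightarrow> 'a \<Rightarrow> nat \<Rightarrow> real" where
  "rseq Y \<omega> = (\<lambda>i\<in>{1..}. Y i \<omega>)"

definition W :: "int \<Rightarrow> nat \<Rightarrow> (nat \<Rightarrow> real) \<Rightarrow> real" where
  "W \<alpha> n y = (if \<alpha> = -1 then Min (y ` {1..n}) else Max (y ` {1..n}))"

definition positive_iid :: "'a measure \<Rightarrow> (nat \<Rightarrow> 'a \<Rightarrow> real) \<Rightarrow> bool" where
  "positive_iid P Y \<longleftrightarrow>
     prob_space.indep_vars P (\<lambda>_. borel) Y {1..} \<and>
     (\<forall>i\<ge>1. distr P borel (Y i) = distr P borel (Y 1)) \<and>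
     (\<forall>i\<ge>1. \<forall>\<omega>\<in>space P. Y i \<omega> > 0)"

text \<open>The data \<open>(N, Y)\<close> of a CCR random variable \<open>\<omega> \<mapsto> W \<alpha> (N \<omega>) (rseq Y \<omega>)\<close>.\<close>

definition CCR :: "'a measure \<Rightarrow> ('a \<Rightarrow> nat) \<Rightarrow> (nat \<Rightarrow> 'a \<Rightarrow> real) \<Rightarrow> bool" where
  "CCR P N Y \<longleftrightarrow>
     N \<in> measurable P (count_space UNIV) \<and>
     (\<forall>\<omega>\<in>space P. N \<omega> \<ge> 1) \<and>
     integrable P (\<lambda>\<omega>. (real (N \<omega>))\<^sup>2) \<and>
     positive_iid P Y \<and>
     indep_rv P (count_space UNIV) N seq_space (rseq Y)"

text \<open>A function on \<open>(0,\<infinity>)\<close> is represented by a function on all reals whose values outside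
  \<open>(0,\<infinity>)\<close> play no role. Both norms below are taken over \<open>(0,\<infinity>)\<close> and may be infinite.\<close>

definition sup_norm :: "(real \<Rightarrow> real) \<Rightarrow> ennreal" where
  "sup_norm h = (SUP x\<in>{0<..}. ennreal \<bar>h x\<bar>)"

definition Lip_b1 :: "(real \<Rightarrow> real) set" where
  "Lip_b1 = {h. 1-lipschitz_on {0<..} h \<and> sup_norm h \<le> 1}"

text \<open>Where \<open>h\<close> is not differentiable, \<open>deriv h\<close> is an
  unspecified constant; for Lipschitz \<open>h\<close> this happens only on a null set.\<close>

definition deriv_norm :: "(real \<Rightarrow> real) \<Rightarrow> ennreal" where
  "deriv_norm h = esssup (lebesgue_on {0<..}) (\<lambda>x. ennreal \<bar>deriv h x\<bar>)"

end

theory Submission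
  imports Defs
begin

text \<open>Insert the mean of \<open>h (W \<alpha> M E)\<close> between the two means. Write \<open>e n\<close> for the mean of
  \<open>h (W \<alpha> n E)\<close>. Since each of \<open>M\<close> and \<open>N\<close> is independent of \<open>E\<close>, the means of \<open>h (W \<alpha> N E)\<close> and
  \<open>h (W \<alpha> M E)\<close> differ by the mean of \<open>e N - e M\<close>, whatever the coupling of \<open>M\<close> and \<open>N\<close>. The
  remaining difference is controlled because minima and maxima of \<open>n\<close> numbers are 1-Lipschitz for the
  \<open>\<ell>\<^sup>1\<close> norm and \<open>M\<close> is independent of the differences \<open>E i - X i\<close>.

  That \<open>\<parallel>h'\<parallel>\<close> is a Lipschitz constant of \<open>h\<close> rests on Lebesgue's theorem: a Lipschitz function is
  differentiable almost everywhere and is the integral of its derivative. After adding a steep linear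
  function it becomes a bijection \<open>G\<close> of the line with Lipschitz inverse; the image of Lebesgue measure
  under the inverse of \<open>G\<close> is absolutely continuous because \<open>G\<close> maps null sets to null sets, and the
  averages of its Radon-Nikodym density converge almost everywhere.\<close>

section \<open>Lipschitz functions on the line\<close>

text \<open>Differentiability is not yet available here: \<open>f\<close> arises as a Radon-Nikodym
  density, with the slope of the added linear function subtracted again.\<close>

lemma lipschitz_has_integral_density:
  fixes g :: "real \<Rightarrow> real"
  assumes "C-lipschitz_on UNIV g"
  obtains f where "\<And>a b. a \<le> b \<Longrightarrow> (f has_integral (g b - g a)) {a..b}"
proof -
  have C: "C \<ge> 0" and lip: "\<And>x y. \<bar>g x - g y\<bar> \<le> C * \<bar>x - y\<bar>"
    using assms by (auto simp: lipschitz_on_def dist_real_def)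
  \<comment> \<open>Slope \<open>C\<close> would only make the sum nondecreasing. The extra 1 makes
    \<open>G\<close> expanding, \<open>G y - G x >= y - x\<close>, which yields injectivity,
    surjectivity and a 1-Lipschitz inverse.\<close>
  define G where "G x = g x + (C + 1) * x" for x
  have G_low: "y - x \<le> G y - G x" and G_up: "\<bar>G y - G x\<bar> \<le> (2 * C + 1) * \<bar>y - x\<bar>" if "x \<le> y" for x y
  proof -
    have "\<bar>g y - g x\<bar> \<le> C * (y - x)" using lip[of y x] that by simp
    moreover have "G y - G x = g y - g x + C * (y - x) + (y - x)" by (simp add: G_def algebra_simps)
    moreover have "(2 * C + 1) * \<bar>y - x\<bar> = C * (y - x) + C * (y - x) + (y - x)"
      using that by (simp add: algebra_simps)
    ultimately show "y - x \<le> G y - G x" "\<bar>G y - G x\<bar> \<le> (2 * C + 1) * \<bar>y - x\<bar>"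
      using that by linarith+
  qed
  have G_lip: "\<bar>G y - G x\<bar> \<le> (2 * C + 1) * \<bar>y - x\<bar>" for x y
    using G_up[of x y] G_up[of y x] by (cases "x \<le> y") (auto simp: abs_minus_commute)
  have G_abs: "\<bar>x - y\<bar> \<le> \<bar>G x - G y\<bar>" for x y
    using G_low[of x y] G_low[of y x] by (cases "x \<le> y") auto
  have G_le: "G x \<le> G y \<longleftrightarrow> x \<le> y" for x y
    using G_low[of x y] G_low[of y x] by (cases "x \<le> y") auto
  have contG: "continuous_on S G" for S
    using G_lip C by (intro lipschitz_on_continuous_on[where L="2 * C + 1"] lipschitz_onI)
      (auto simp: dist_real_def)
  \<comment> \<open>Expansion puts \<open>v\<close> between the values of \<open>G\<close> at 0 and
    at \<open>v - G 0\<close>, so these two points serve as the ends for the intermediate value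
    theorem.\<close>
  have "\<exists>x. G x = v" for v
  proof (cases "G 0 \<le> v")
    case True
    then show ?thesis
      using IVT'[of G 0 v "v - G 0"] G_low[of 0 "v - G 0"] contG by auto
  next
    case False
    then show ?thesis
      using IVT'[of G "v - G 0" v 0] G_low[of "v - G 0" 0] contG by auto
  qed
  then have "surj G" by (metis surjI)
  moreover have "inj G" using G_le by (intro injI order_antisym) (metis order_refl)+
  ultimately have "bij G" by (simp add: bij_def)
  define K where "K = inv G"
  have GK[simp]: "G (K v) = v" and KG[simp]: "K (G v) = v" for v
    using \<open>bij G\<close> by (auto simp: K_def bij_def surj_f_inv_f)
  have contK: "continuous_on UNIV K"
    using G_abs[of "K _" "K _"]
    by (intro lipschitz_on_continuous_on[where L=1] lipschitz_onI) (auto simp: dist_real_def)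
  then have [measurable]: "K \<in> borel_measurable borel"
    by (rule borel_measurable_continuous_onI)
  \<comment> \<open>This measure gives a Borel set the Lebesgue measure of its image under
    \<open>G\<close>, so the interval from \<open>a\<close> to \<open>b\<close> has mass
    \<open>G b - G a\<close>.\<close>
  define \<mu> where "\<mu> = distr lborel borel K"
  have vim: "K -` A = G ` A" for A
    by (auto simp: image_iff) (metis GK)
  have \<mu>: "emeasure \<mu> A = emeasure lborel (G ` A)" if "A \<in> sets borel" for A
    using that by (simp add: \<mu>_def emeasure_distr vim)
  have "absolutely_continuous lborel \<mu>"
    unfolding absolutely_continuous_def
  proof
    fix A :: "real set" assume A: "A \<in> null_sets lborel"
    then have [measurable]: "A \<in> sets borel" by auto
    have "negligible A" using A by (simp add: negligible_iff_null_sets null_sets_completionI)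
    then have "negligible (G ` A)"
      using G_lip by (intro negligible_locally_Lipschitz_image) (auto intro!: exI[of _ UNIV])
    \<comment> \<open>Negligible sets live in the completion of \<open>lborel\<close>. That the
      image is Borel, being a preimage under \<open>K\<close>, brings the statement back to
      \<open>lborel\<close> itself.\<close>
    moreover have "G ` A \<in> sets borel"
      using vim[of A] measurable_sets_borel[of K borel A] by simp
    ultimately have "emeasure lborel (G ` A) = 0"
      by (auto simp: negligible_iff_null_sets null_sets_completion_iff)
    then show "A \<in> null_sets \<mu>"
      using \<mu>[of A] by (auto simp: null_sets_def \<mu>_def)
  qed
  then obtain f0 where [measurable]: "f0 \<in> borel_measurable lborel" and f0: "density lborel f0 = \<mu>"
    using sigma_finite_measure.Radon_Nikodym[OF sigma_finite_lborel, of \<mu>] by (auto simp: \<mu>_def)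
  \<comment> \<open>The density may take the value infinity, which \<open>enn2real\<close> turns
    into 0. Each bounded interval has finite mass, so this alters the density there only on a null
    set. Subtracting \<open>C + 1\<close> undoes the passage from \<open>g\<close> to
    \<open>G\<close>.\<close>
  have "((\<lambda>x. enn2real (f0 x) - (C + 1)) has_integral (g b - g a)) {a..b}" if "a \<le> b" for a b
  proof -
    have "G ` {a..b} = {G a..G b}"
    proof safe
      fix v assume "v \<in> {G a..G b}"
      then have "v = G (K v)" "K v \<in> {a..b}" using G_le[of a "K v"] G_le[of "K v" b] by auto
      then show "v \<in> G ` {a..b}" by blast
    qed (auto simp: G_le)
    then have "emeasure \<mu> {a..b} = ennreal (G b - G a)"
      using \<mu>[of "{a..b}"] G_low[OF that] that by simp
    then have nn: "(\<integral>\<^sup>+x. f0 x * indicator {a..b} x \<partial>lborel) = ennreal (G b - G a)"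
      by (simp add: f0[symmetric] emeasure_density)
    then have "AE x in lborel. f0 x * indicator {a..b} x \<noteq> \<infinity>"
      by (intro nn_integral_PInf_AE) auto
    then have "(\<integral>\<^sup>+x. ennreal (enn2real (f0 x) * indicator {a..b} x) \<partial>lborel)
        = (\<integral>\<^sup>+x. f0 x * indicator {a..b} x \<partial>lborel)"
      by (intro nn_integral_cong_AE) (auto elim!: eventually_mono simp: indicator_def less_top)
    then have "((\<lambda>x. enn2real (f0 x) * indicator {a..b} x) has_integral (G b - G a)) UNIV"
      using nn G_low[OF that] that
      by (intro nn_integral_has_integral) (auto simp: indicator_def)
    moreover have "(\<lambda>x. enn2real (f0 x) * indicator {a..b} x)
        = (\<lambda>x. if x \<in> {a..b} then enn2real (f0 x) else 0)"
      by auto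
    ultimately have "((\<lambda>x. enn2real (f0 x)) has_integral (G b - G a)) {a..b}"
      by (simp only: has_integral_restrict_UNIV)
    from has_integral_diff[OF this has_integral_const_real[of "C + 1" a b]]
    show ?thesis using that by (simp add: G_def algebra_simps)
  qed
  then show thesis by (rule that)
qed

text \<open>The differentiation theorem used here averages over cubes that have \<open>x\<close> as
  their lower corner, on the line over \<open>{x..x + h}\<close>. It therefore yields only the
  derivative from the right.\<close>

lemma right_derivative_of_integral:
  fixes f g :: "real \<Rightarrow> real"
  assumes "\<And>a b. a \<le> b \<Longrightarrow> (f has_integral (g b - g a)) {a..b}"
  obtains S where "negligible S"
    "\<And>x. x \<notin> S \<Longrightarrow> (g has_real_derivative f x) (at_right x)"
proof -
  have int: "f integrable_on cbox a b" for a b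
    using assms[of a b] by (cases "a \<le> b") (auto simp: has_integral_integrable)
  obtain S where S: "negligible S" and *:
    "\<And>x e. x \<notin> S \<Longrightarrow> 0 < e \<Longrightarrow> \<exists>d>0. \<forall>h. 0 < h \<and> h < d \<longrightarrow>
       norm (integral (cbox x (x + h *\<^sub>R One)) f /\<^sub>R h ^ DIM(real) - f x) < e"
    using integrable_ccontinuous_explicit[OF int] by metis
  have "(g has_real_derivative f x) (at_right x)" if "x \<notin> S" for x
    unfolding has_field_derivative_iff
  proof (rule tendstoI)
    fix e :: real assume "e > 0"
    from *[OF that this] obtain d where "d > 0" and d: "\<And>h. 0 < h \<Longrightarrow> h < d \<Longrightarrow>
       \<bar>integral {x..x + h} f / h - f x\<bar> < e"
      by (auto simp: divide_inverse mult.commute)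
    have "dist ((g y - g x) / (y - x)) (f x) < e" if "x < y" "y < x + d" for y
      using d[of "y - x"] that integral_unique[OF assms[of x y]] by (simp add: dist_real_def)
    then show "eventually (\<lambda>y. dist ((g y - g x) / (y - x)) (f x) < e) (at_right x)"
      using \<open>d > 0\<close> unfolding eventually_at_right_field by (intro exI[of _ "x + d"]) auto
  qed
  with S show thesis by (rule that)
qed

text \<open>The left derivative comes by reflection: \<open>- g (- x)\<close> has the density
  \<open>f (- x)\<close>, and its right derivative at \<open>- x\<close> is the left derivative of
  \<open>g\<close> at \<open>x\<close>. The reflected exceptional set is again negligible.\<close>

lemma lipschitz_AE_differentiable_integral:
  fixes g :: "real \<Rightarrow> real"
  assumes "C-lipschitz_on UNIV g"
  obtains f S where "\<And>a b. a \<le> b \<Longrightarrow> (f has_integral (g b - g a)) {a..b}"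
    and "negligible S" "\<And>x. x \<notin> S \<Longrightarrow> (g has_real_derivative f x) (at x)"
proof -
  obtain f where f: "\<And>a b. a \<le> b \<Longrightarrow> (f has_integral (g b - g a)) {a..b}"
    using lipschitz_has_integral_density[OF assms] by metis
  have refl: "((\<lambda>x. f (- x)) has_integral (- g (- b) - - g (- a))) {a..b}" if "a \<le> b" for a b
    using has_integral_reflect_lemma_real[OF f[of "-b" "-a"]] that by simp
  obtain S where S: "negligible S" "\<And>x. x \<notin> S \<Longrightarrow> (g has_real_derivative f x) (at_right x)"
    using right_derivative_of_integral[OF f] by metis
  obtain T where T: "negligible T"
    "\<And>x. x \<notin> T \<Longrightarrow> ((\<lambda>x. - g (- x)) has_real_derivative f (- x)) (at_right x)"
    using right_derivative_of_integral[of "\<lambda>x. f (- x)" "\<lambda>x. - g (- x)", OF refl] by metis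
  have "negligible (uminus ` T)"
    using T(1) by (intro negligible_locally_Lipschitz_image) (auto intro!: exI[of _ UNIV] exI[of _ "1::real"] simp: abs_minus_commute)
  then have "negligible (S \<union> uminus ` T)" using S(1) by simp
  moreover have "(g has_real_derivative f x) (at x)" if "x \<notin> S \<union> uminus ` T" for x
  proof -
    have "- x \<notin> T" using that by (metis UnI2 add.inverse_inverse imageI)
    then have "((\<lambda>x. - g (- x)) has_real_derivative f x) (at_right (- x))" using T(2) by fastforce
    then have "((\<lambda>y. (- g (- y) - - g (- (- x))) / (y - - x)) \<longlongrightarrow> f x) (at_right (- x))"
      by (simp only: has_field_derivative_iff)
    then have "((\<lambda>y. (- g y + g x) / (- y + x)) \<longlongrightarrow> f x) (at_left x)"
      by (simp add: filterlim_at_left_to_right add.commute)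
    moreover have "(- g y + g x) / (- y + x) = (g y - g x) / (y - x)" for y
      using minus_divide_divide[of "g y - g x" "y - x"] by (simp add: add.commute)
    ultimately have "((\<lambda>y. (g y - g x) / (y - x)) \<longlongrightarrow> f x) (at_left x)" by simp
    moreover have "((\<lambda>y. (g y - g x) / (y - x)) \<longlongrightarrow> f x) (at_right x)"
      using S(2)[of x] that by (simp add: has_field_derivative_iff)
    ultimately show ?thesis
      by (simp add: has_field_derivative_iff filterlim_split_at)
  qed
  ultimately show thesis using f that by blast
qed

text \<open>For \<open>x <= y\<close> the increment of \<open>h\<close> is the integral of a density
  that agrees almost everywhere with \<open>deriv h\<close>, hence is almost everywhere at most the
  essential supremum in absolute value.\<close>

lemma lipschitz_diff_le_deriv_norm:
  assumes "C-lipschitz_on {0<..} h" "x > 0" "y > 0"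
  shows "ennreal \<bar>h x - h y\<bar> \<le> deriv_norm h * ennreal \<bar>x - y\<bar>"
  using assms(2,3)
proof (induction x y rule: linorder_wlog)
  case (le x y)
  show ?case
  proof (cases "deriv_norm h = top")
    case True
    \<comment> \<open>In \<open>ennreal\<close> the product of top and 0 is 0, so the case
      \<open>x = y\<close>, where both sides vanish, is treated apart.\<close>
    then show ?thesis by (cases "x = y") (auto simp: ennreal_top_mult)
  next
    case False
    then obtain L where L: "L \<ge> 0" "deriv_norm h = ennreal L"
      by (metis ennreal_cases)
    have lip: "C \<ge> 0" "\<And>u v. u > 0 \<Longrightarrow> v > 0 \<Longrightarrow> \<bar>h u - h v\<bar> \<le> C * \<bar>u - v\<bar>"
      using assms(1) by (auto simp: lipschitz_on_def dist_real_def)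
    \<comment> \<open>The results above concern functions on the whole line. Freezing
      \<open>h\<close> to the left of \<open>x\<close> extends it with the same Lipschitz constant
      and changes nothing on \<open>{x..y}\<close>.\<close>
    have "C-lipschitz_on UNIV (\<lambda>u. h (max x u))"
    proof (rule lipschitz_onI)
      fix u v :: real
      have "\<bar>h (max x u) - h (max x v)\<bar> \<le> C * \<bar>max x u - max x v\<bar>"
        using le by (intro lip) auto
      also have "\<dots> \<le> C * \<bar>u - v\<bar>" using lip(1) by (intro mult_left_mono) auto
      finally show "dist (h (max x u)) (h (max x v)) \<le> C * dist u v" by (simp add: dist_real_def)
    qed (fact lip(1))
    then obtain f S where f: "\<And>a b. a \<le> b \<Longrightarrow> (f has_integral (h (max x b) - h (max x a))) {a..b}"
      and S: "negligible S" "\<And>u. u \<notin> S \<Longrightarrow> ((\<lambda>u. h (max x u)) has_real_derivative f u) (at u)"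
      using lipschitz_AE_differentiable_integral by metis
    have "AE u in lebesgue_on {0<..}. ennreal \<bar>deriv h u\<bar> \<le> ennreal L"
      using esssup_AE[of "\<lambda>x. ennreal \<bar>deriv h x\<bar>" "lebesgue_on {0<..}"] L(2) by (simp add: deriv_norm_def)
    then have "AE u in lebesgue. u \<in> {0<..} \<longrightarrow> \<bar>deriv h u\<bar> \<le> L"
      by (simp add: AE_restrict_space_iff L(1))
    then obtain T where T: "T \<in> null_sets lebesgue" "\<And>u. u \<notin> T \<Longrightarrow> u > 0 \<Longrightarrow> \<bar>deriv h u\<bar> \<le> L"
      by (auto simp: eventually_ae_filter)
    have bound: "\<bar>f u\<bar> \<le> L" if "u \<in> {x..y} - (S \<union> T \<union> {x})" for u
    proof -
      have "(h has_real_derivative f u) (at u)"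
      proof (rule DERIV_cong_ev[OF refl _ refl, THEN iffD1])
        show "((\<lambda>u. h (max x u)) has_real_derivative f u) (at u)" using S(2) that by blast
        show "eventually (\<lambda>u. h (max x u) = h u) (nhds u)"
          using that unfolding eventually_nhds by (intro exI[of _ "{x<..}"]) auto
      qed
      then show ?thesis using T(2)[of u] that le by (simp add: DERIV_imp_deriv)
    qed
    have neg: "negligible (S \<union> T \<union> {x})" using S(1) T(1) by (simp add: negligible_iff_null_sets[symmetric])
    have "(f has_integral (h y - h x)) {x..y}" using f[OF le(1)] le(1) by (simp add: max_absorb2)
    \<comment> \<open>Setting the density to 0 on the null set makes the bound \<open>L\<close> hold
      at every point, as the integral estimate requires.\<close>
    then have "((\<lambda>u. if u \<in> S \<union> T \<union> {x} then 0 else f u) has_integral (h y - h x)) {x..y}"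
      by (rule has_integral_spike[OF neg, rotated]) simp
    then have "norm (h y - h x) \<le> L * measure lborel {x..y}"
      by (rule has_integral_bound_real[OF L(1) finite.emptyI]) (use bound L(1) in auto)
    then have "\<bar>h x - h y\<bar> \<le> L * \<bar>x - y\<bar>"
      using le(1) by (simp add: abs_minus_commute)
    then show ?thesis using L by (simp add: ennreal_mult[symmetric] ennreal_leI)
  qed
next
  case (sym x y)
  then show ?case by (simp add: abs_minus_commute)
qed

section \<open>Random minima and maxima\<close>

text \<open>With the unordered sums of the theorem written as integrals against counting measure,
  exchanging sum and expectation is an exchange of two nonnegative integrals.\<close>

lemma ennreal_infsum_eq_nn_integral:
  fixes f :: "'a \<Rightarrow> ennreal"
  assumes "countable A"
  shows "infsum f A = (\<integral>\<^sup>+x. f x \<partial>count_space A)"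
proof (cases "finite A")
  case True
  then show ?thesis by (simp add: nn_integral_count_space_finite)
next
  case False
  then have bij: "bij_betw (from_nat_into A) UNIV A"
    using assms by (intro bij_betw_from_nat_into)
  have "(\<lambda>n. f (from_nat_into A n)) sums (\<Sum>\<^sub>\<infinity>n. f (from_nat_into A n))"
    by (intro has_sum_imp_sums has_sum_infsum nonneg_summable_on_complete) auto
  then have "infsum f A = (\<Sum>n. f (from_nat_into A n))"
    by (simp add: infsum_reindex_bij_betw[OF bij] sums_iff)
  then show ?thesis
    by (simp add: nn_integral_bij_count_space[OF bij, symmetric] nn_integral_count_space_nat)
qed

lemma Min_image_diff_le_sum:
  fixes x y :: "'i \<Rightarrow> real"
  assumes "finite I" "I \<noteq> {}"
  shows "\<bar>Min (x ` I) - Min (y ` I)\<bar> \<le> (\<Sum>i\<in>I. \<bar>x i - y i\<bar>)"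
proof -
  have *: "Min (u ` I) \<le> Min (v ` I) + (\<Sum>i\<in>I. \<bar>u i - v i\<bar>)" for u v :: "'i \<Rightarrow> real"
  proof -
    have "Min (v ` I) \<in> v ` I" using assms by (intro Min_in) auto
    then obtain i where i: "i \<in> I" "Min (v ` I) = v i" by blast
    have "Min (u ` I) \<le> u i" using i assms by (intro Min_le) auto
    moreover have "\<bar>u i - v i\<bar> \<le> (\<Sum>i\<in>I. \<bar>u i - v i\<bar>)"
      using i assms by (intro member_le_sum) auto
    ultimately show ?thesis using i by linarith
  qed
  from *[of x y] *[of y x] show ?thesis by (simp add: abs_minus_commute)
qed

lemma W_diff_le_sum:
  assumes "n \<ge> 1"
  shows "\<bar>W \<alpha> n x - W \<alpha> n y\<bar> \<le> (\<Sum>i=1..n. \<bar>x i - y i\<bar>)"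
proof (cases "\<alpha> = -1")
  case True
  then show ?thesis using Min_image_diff_le_sum[of "{1..n}" x y] assms by (simp add: W_def)
next
  case False
  \<comment> \<open>A maximum is the negative of the minimum of the negated values, which reduces
    this case to the previous lemma.\<close>
  have "W \<alpha> n z = - Min ((\<lambda>i. - z i) ` {1..n})" for z
    using minus_Max_eq_Min[of "z ` {1..n}"] assms False by (simp add: W_def image_image)
  then show ?thesis
    using Min_image_diff_le_sum[of "{1..n}" "\<lambda>i. - x i" "\<lambda>i. - y i"] assms
    by (simp add: abs_minus_commute del: minus_Min_eq_Max)
qed

lemma W_pos:
  assumes "n \<ge> 1" "\<And>i. i \<ge> 1 \<Longrightarrow> x i > 0"
  shows "W \<alpha> n x > 0"
  using assms by (auto simp: W_def Max_gr_iff Suc_le_eq intro!: exI[of _ 1])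

lemma measurable_seq_space_component:
  "i \<ge> 1 \<Longrightarrow> (\<lambda>x. x i) \<in> borel_measurable seq_space"
  unfolding seq_space_def by measurable

lemma borel_measurable_W:
  assumes "n \<ge> 1"
  shows "W \<alpha> n \<in> borel_measurable seq_space"
proof (cases "\<alpha> = -1")
  case True
  then have "W \<alpha> n = (\<lambda>x. Min ((\<lambda>i. x i) ` {1..n}))" by (simp add: W_def fun_eq_iff)
  also have "\<dots> \<in> borel_measurable seq_space"
    using assms by (intro borel_measurable_Min measurable_seq_space_component) auto
  finally show ?thesis .
next
  case False
  then have "W \<alpha> n = (\<lambda>x. Max ((\<lambda>i. x i) ` {1..n}))" by (simp add: W_def fun_eq_iff)
  also have "\<dots> \<in> borel_measurable seq_space"
    using assms by (intro borel_measurable_Max measurable_seq_space_component) auto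
  finally show ?thesis .
qed

text \<open>Replaces \<open>h \<circ> W \<alpha>\<close> by a jointly measurable bounded function: \<open>h\<close> is arbitrary outside
  \<open>(0,\<infinity>)\<close>, and \<open>W \<alpha> 0\<close> is an unspecified extremum of the empty set.\<close>

lemma obtain_measurable_extremum_function:
  fixes h :: "real \<Rightarrow> real"
  assumes h: "continuous_on {0<..} h" "\<And>x. x > 0 \<Longrightarrow> \<bar>h x\<bar> \<le> B"
  obtains F where "case_prod F \<in> borel_measurable (count_space UNIV \<Otimes>\<^sub>M seq_space)"
    and "\<And>n x. \<bar>F n x\<bar> \<le> B"
    and "\<And>n x. n \<ge> 1 \<Longrightarrow> (\<And>i. i \<ge> 1 \<Longrightarrow> x i > 0) \<Longrightarrow> F n x = h (W \<alpha> n x)"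
proof
  define h' where "h' x = indicator {0<..} x *\<^sub>R h x" for x
  define F where "F n = (\<lambda>x. h' (W \<alpha> (max 1 n) x))" for n
  have [measurable]: "h' \<in> borel_measurable borel"
    unfolding h'_def using h(1) by (intro borel_measurable_continuous_on_indicator) auto
  have [measurable]: "F n \<in> borel_measurable seq_space" for n
    unfolding F_def by (rule measurable_compose[OF borel_measurable_W]) auto
  show "case_prod F \<in> borel_measurable (count_space UNIV \<Otimes>\<^sub>M seq_space)"
    by (intro measurable_pair_measure_countable1) auto
  have "B \<ge> 0" using h(2)[of 1] by auto
  then show "\<bar>F n x\<bar> \<le> B" for n x
    using h(2) by (auto simp: F_def h'_def indicator_def)
  show "F n x = h (W \<alpha> n x)" if "n \<ge> 1" "\<And>i. i \<ge> 1 \<Longrightarrow> x i > 0" for n x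
    using that W_pos[of n x \<alpha>] by (simp add: F_def h'_def max_def)
qed

lemma rseq_pos:
  assumes "positive_iid M X" "\<omega> \<in> space M" "i \<ge> 1"
  shows "rseq X \<omega> i > 0"
  using assms by (auto simp: positive_iid_def rseq_def)

section \<open>Integration under independence and the two error bounds\<close>

context prob_space
begin

text \<open>Independence is the product formula on measurable rectangles, and these determine a
  product of sigma-finite measures.\<close>

lemma indep_rv_distr_Pair:
  assumes "indep_rv M S U T V"
  shows "distr M (S \<Otimes>\<^sub>M T) (\<lambda>\<omega>. (U \<omega>, V \<omega>)) = distr M S U \<Otimes>\<^sub>M distr M T V"
proof -
  have [measurable]: "U \<in> measurable M S" "V \<in> measurable M T"
    and ind: "indep_set {U -` A \<inter> space M | A. A \<in> sets S} {V -` B \<inter> space M | B. B \<in> sets T}"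
    using assms by (auto simp: indep_rv_def)
  interpret U: prob_space "distr M S U" by (rule prob_space_distr) simp
  interpret V: prob_space "distr M T V" by (rule prob_space_distr) simp
  show ?thesis
  proof (rule pair_measure_eqI[symmetric])
    fix A B assume "A \<in> sets (distr M S U)" "B \<in> sets (distr M T V)"
    then have AB[measurable]: "A \<in> sets S" "B \<in> sets T" by auto
    have "prob ((U -` A \<inter> space M) \<inter> (V -` B \<inter> space M))
        = prob (U -` A \<inter> space M) * prob (V -` B \<inter> space M)"
      using AB by (intro indep_setD[OF ind]) auto
    moreover have "(\<lambda>\<omega>. (U \<omega>, V \<omega>)) -` (A \<times> B) \<inter> space M
        = (U -` A \<inter> space M) \<inter> (V -` B \<inter> space M)" by auto
    ultimately show "emeasure (distr M S U) A * emeasure (distr M T V) B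
        = emeasure (distr M (S \<Otimes>\<^sub>M T) (\<lambda>\<omega>. (U \<omega>, V \<omega>))) (A \<times> B)"
      by (simp add: emeasure_distr emeasure_eq_measure ennreal_mult)
  qed (auto intro: U.sigma_finite_measure_axioms V.sigma_finite_measure_axioms)
qed

text \<open>Tonelli for the product law. The second sample point \<open>\<omega>'\<close> stands for
  an independent copy of \<open>V\<close>, so that both integrals run over the original
  space.\<close>

lemma indep_rv_nn_integral:
  assumes ind: "indep_rv M S U T V"
    and [measurable]: "case_prod F \<in> borel_measurable (S \<Otimes>\<^sub>M T)"
  shows "(\<integral>\<^sup>+\<omega>. F (U \<omega>) (V \<omega>) \<partial>M) = (\<integral>\<^sup>+\<omega>. (\<integral>\<^sup>+\<omega>'. F (U \<omega>) (V \<omega>') \<partial>M) \<partial>M)"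
proof -
  have [measurable]: "U \<in> measurable M S" "V \<in> measurable M T"
    using ind by (auto simp: indep_rv_def)
  interpret V: prob_space "distr M T V" by (rule prob_space_distr) simp
  have "(\<integral>\<^sup>+\<omega>. F (U \<omega>) (V \<omega>) \<partial>M) = (\<integral>\<^sup>+z. case_prod F z \<partial>distr M (S \<Otimes>\<^sub>M T) (\<lambda>\<omega>. (U \<omega>, V \<omega>)))"
    by (subst nn_integral_distr) auto
  also have "\<dots> = (\<integral>\<^sup>+u. (\<integral>\<^sup>+v. F u v \<partial>distr M T V) \<partial>distr M S U)"
    unfolding indep_rv_distr_Pair[OF ind] by (subst V.nn_integral_fst[symmetric]) auto
  also have "\<dots> = (\<integral>\<^sup>+\<omega>. (\<integral>\<^sup>+v. F (U \<omega>) v \<partial>distr M T V) \<partial>M)"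
    by (subst nn_integral_distr) auto
  also have "\<dots> = (\<integral>\<^sup>+\<omega>. (\<integral>\<^sup>+\<omega>'. F (U \<omega>) (V \<omega>') \<partial>M) \<partial>M)"
    by (intro nn_integral_cong nn_integral_distr) (auto dest: measurable_space)
  finally show ?thesis .
qed

text \<open>The signed counterpart, with boundedness supplying the integrability that Fubini asks
  for.\<close>

lemma indep_rv_integral:
  fixes F :: "'b \<Rightarrow> 'c \<Rightarrow> real"
  assumes ind: "indep_rv M S U T V"
    and [measurable]: "case_prod F \<in> borel_measurable (S \<Otimes>\<^sub>M T)"
    and bound: "\<And>u v. \<bar>F u v\<bar> \<le> B"
  shows "(\<integral>\<omega>. F (U \<omega>) (V \<omega>) \<partial>M) = (\<integral>\<omega>. (\<integral>\<omega>'. F (U \<omega>) (V \<omega>') \<partial>M) \<partial>M)"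
proof -
  have [measurable]: "U \<in> measurable M S" "V \<in> measurable M T"
    using ind by (auto simp: indep_rv_def)
  interpret U: prob_space "distr M S U" by (rule prob_space_distr) simp
  interpret V: prob_space "distr M T V" by (rule prob_space_distr) simp
  interpret UV: pair_prob_space "distr M S U" "distr M T V" ..
  have "integrable (distr M S U \<Otimes>\<^sub>M distr M T V) (case_prod F)"
    using bound by (intro UV.P.integrable_const_bound[of _ B]) auto
  from UV.integral_fst'[OF this]
  have "(\<integral>u. (\<integral>v. F u v \<partial>distr M T V) \<partial>distr M S U)
      = (\<integral>z. case_prod F z \<partial>distr M (S \<Otimes>\<^sub>M T) (\<lambda>\<omega>. (U \<omega>, V \<omega>)))"
    unfolding indep_rv_distr_Pair[OF ind] by simp
  also have "\<dots> = (\<integral>\<omega>. F (U \<omega>) (V \<omega>) \<partial>M)"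
    by (subst integral_distr) auto
  finally have "(\<integral>\<omega>. F (U \<omega>) (V \<omega>) \<partial>M) = (\<integral>u. (\<integral>v. F u v \<partial>distr M T V) \<partial>distr M S U)" ..
  also have "\<dots> = (\<integral>\<omega>. (\<integral>v. F (U \<omega>) v \<partial>distr M T V) \<partial>M)"
    by (subst integral_distr) auto
  also have "\<dots> = (\<integral>\<omega>. (\<integral>\<omega>'. F (U \<omega>) (V \<omega>') \<partial>M) \<partial>M)"
    by (intro Bochner_Integration.integral_cong integral_distr refl) (auto dest: measurable_space)
  finally show ?thesis .
qed

text \<open>With the same index on both sides, the extrema differ pathwise by at most the sum of
  \<open>\<bar>X i - Y i\<bar>\<close> over \<open>i\<close> up to \<open>U\<close>. Taken over all
  \<open>i\<close> with the indicator of \<open>U >= i\<close>, this sum can be exchanged with the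
  expectation, and independence factors each term. Everything stays in \<open>ennreal\<close>, so
  infinite right-hand sides are covered.\<close>

lemma random_extremum_coupling_bound:
  fixes U :: "'a \<Rightarrow> nat" and X Y :: "nat \<Rightarrow> 'a \<Rightarrow> real"
  assumes ind: "indep_rv M (count_space UNIV) U (seq_space \<Otimes>\<^sub>M seq_space) (\<lambda>\<omega>. (rseq X \<omega>, rseq Y \<omega>))"
    and U_ge: "\<And>\<omega>. \<omega> \<in> space M \<Longrightarrow> U \<omega> \<ge> 1"
    and pos: "\<And>i \<omega>. \<omega> \<in> space M \<Longrightarrow> i \<ge> 1 \<Longrightarrow> rseq X \<omega> i > 0" "\<And>i \<omega>. \<omega> \<in> space M \<Longrightarrow> i \<ge> 1 \<Longrightarrow> rseq Y \<omega> i > 0"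
    and h: "C-lipschitz_on {0<..} h" "\<And>x. x > 0 \<Longrightarrow> \<bar>h x\<bar> \<le> B"
  shows "ennreal \<bar>(\<integral>\<omega>. h (W \<alpha> (U \<omega>) (rseq X \<omega>)) \<partial>M) - (\<integral>\<omega>. h (W \<alpha> (U \<omega>) (rseq Y \<omega>)) \<partial>M)\<bar>
    \<le> deriv_norm h * (\<Sum>\<^sub>\<infinity>i\<in>{1..}. (\<integral>\<^sup>+\<omega>. ennreal \<bar>X i \<omega> - Y i \<omega>\<bar> \<partial>M) * ennreal (prob {\<omega> \<in> space M. U \<omega> \<ge> i}))"
proof -
  have [measurable]: "U \<in> measurable M (count_space UNIV)"
    and XY[measurable]: "(\<lambda>\<omega>. (rseq X \<omega>, rseq Y \<omega>)) \<in> measurable M (seq_space \<Otimes>\<^sub>M seq_space)"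
    using ind by (auto simp: indep_rv_def)
  have [measurable]: "rseq X \<in> measurable M seq_space" "rseq Y \<in> measurable M seq_space"
    using measurable_compose[OF XY measurable_fst] measurable_compose[OF XY measurable_snd] by auto
  have seq: "rseq Z \<omega> i = Z i \<omega>" if "i \<ge> 1" for Z :: "nat \<Rightarrow> 'a \<Rightarrow> real" and i \<omega>
    using that by (simp add: rseq_def)
  let ?f = "\<lambda>\<omega>. h (W \<alpha> (U \<omega>) (rseq X \<omega>))" and ?g = "\<lambda>\<omega>. h (W \<alpha> (U \<omega>) (rseq Y \<omega>))"
  let ?D = "\<lambda>i \<omega>. ennreal \<bar>X i \<omega> - Y i \<omega>\<bar>"
  have XY_meas: "X i \<in> borel_measurable M" "Y i \<in> borel_measurable M" if "i \<ge> 1" for i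
  proof -
    note [measurable] = measurable_seq_space_component[OF that]
    have "(\<lambda>\<omega>. rseq X \<omega> i) \<in> borel_measurable M" "(\<lambda>\<omega>. rseq Y \<omega> i) \<in> borel_measurable M" by measurable
    then show "X i \<in> borel_measurable M" "Y i \<in> borel_measurable M" by (simp_all add: seq[OF that])
  qed
  have [measurable]: "(\<lambda>\<omega>. indicator {i..} (U \<omega>) :: ennreal) \<in> borel_measurable M" for i
    by (rule measurable_compose[where N="count_space UNIV"]) simp_all
  have Wpos: "W \<alpha> (U \<omega>) (rseq X \<omega>) > 0" "W \<alpha> (U \<omega>) (rseq Y \<omega>) > 0" if "\<omega> \<in> space M" for \<omega>
    using that U_ge pos by (auto intro!: W_pos)
  \<comment> \<open>Here \<open>F\<close> serves to prove that \<open>?f\<close> and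
    \<open>?g\<close> are integrable: on the sample space they agree with bounded measurable
    functions.\<close>
  obtain F where [measurable]: "case_prod F \<in> borel_measurable (count_space UNIV \<Otimes>\<^sub>M seq_space)"
    and F: "\<And>n x. \<bar>F n x\<bar> \<le> B" "\<And>n x. n \<ge> 1 \<Longrightarrow> (\<And>i. i \<ge> 1 \<Longrightarrow> x i > 0) \<Longrightarrow> F n x = h (W \<alpha> n x)"
    using obtain_measurable_extremum_function[OF lipschitz_on_continuous_on[OF h(1)] h(2)] by metis
  have int: "integrable M ?f" "integrable M ?g"
  proof -
    have "integrable M (\<lambda>\<omega>. F (U \<omega>) (rseq X \<omega>))" "integrable M (\<lambda>\<omega>. F (U \<omega>) (rseq Y \<omega>))"
      using F(1) by (auto intro!: integrable_const_bound[of _ B])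
    moreover have "F (U \<omega>) (rseq X \<omega>) = ?f \<omega>" "F (U \<omega>) (rseq Y \<omega>) = ?g \<omega>" if "\<omega> \<in> space M" for \<omega>
      using that by (auto intro!: F(2) U_ge pos)
    ultimately show "integrable M ?f" "integrable M ?g"
      by (auto cong: Bochner_Integration.integrable_cong)
  qed
  have "ennreal \<bar>(\<integral>\<omega>. ?f \<omega> \<partial>M) - (\<integral>\<omega>. ?g \<omega> \<partial>M)\<bar> = ennreal (norm (\<integral>\<omega>. ?f \<omega> - ?g \<omega> \<partial>M))"
    using int by simp
  also have "\<dots> \<le> (\<integral>\<^sup>+\<omega>. ennreal \<bar>?f \<omega> - ?g \<omega>\<bar> \<partial>M)"
    using integral_norm_bound_ennreal[OF Bochner_Integration.integrable_diff[OF int]] by simp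
  also have "\<dots> \<le> (\<integral>\<^sup>+\<omega>. (\<integral>\<^sup>+i. deriv_norm h * (?D i \<omega> * indicator {i..} (U \<omega>)) \<partial>count_space {1..}) \<partial>M)"
  proof (rule nn_integral_mono)
    fix \<omega> assume \<omega>: "\<omega> \<in> space M"
    have "ennreal \<bar>?f \<omega> - ?g \<omega>\<bar> \<le> deriv_norm h * ennreal \<bar>W \<alpha> (U \<omega>) (rseq X \<omega>) - W \<alpha> (U \<omega>) (rseq Y \<omega>)\<bar>"
      using lipschitz_diff_le_deriv_norm[OF h(1) Wpos[OF \<omega>]] .
    also have "ennreal \<bar>W \<alpha> (U \<omega>) (rseq X \<omega>) - W \<alpha> (U \<omega>) (rseq Y \<omega>)\<bar>
        \<le> ennreal (\<Sum>i=1..U \<omega>. \<bar>rseq X \<omega> i - rseq Y \<omega> i\<bar>)"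
      using W_diff_le_sum[OF U_ge[OF \<omega>]] by (rule ennreal_leI)
    also have "\<dots> = (\<Sum>i=1..U \<omega>. ?D i \<omega> * indicator {i..} (U \<omega>))"
      by (subst sum_ennreal[symmetric]) (auto simp: seq intro!: sum.cong)
    \<comment> \<open>The indicator vanishes for \<open>i\<close> beyond \<open>U \<omega>\<close>,
      so the random upper limit disappears from the range of summation.\<close>
    also have "\<dots> = (\<integral>\<^sup>+i. ?D i \<omega> * indicator {i..} (U \<omega>) \<partial>count_space {1..})"
      by (rule nn_integral_count_space'[symmetric]) (auto simp: indicator_def)
    finally show "ennreal \<bar>?f \<omega> - ?g \<omega>\<bar>
        \<le> (\<integral>\<^sup>+i. deriv_norm h * (?D i \<omega> * indicator {i..} (U \<omega>)) \<partial>count_space {1..})"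
      by (simp add: mult_left_mono nn_integral_cmult)
  qed
  also have "\<dots> = (\<integral>\<^sup>+i. (\<integral>\<^sup>+\<omega>. deriv_norm h * (?D i \<omega> * indicator {i..} (U \<omega>)) \<partial>M) \<partial>count_space {1..})"
  proof (rule nn_integral_count_space_nn_integral)
    fix i :: nat assume "i \<in> {1..}"
    then have [measurable]: "X i \<in> borel_measurable M" "Y i \<in> borel_measurable M"
      using XY_meas by simp_all
    show "(\<lambda>\<omega>. deriv_norm h * (?D i \<omega> * indicator {i..} (U \<omega>))) \<in> borel_measurable M" by measurable
  qed auto
  also have "\<dots> = (\<integral>\<^sup>+i. deriv_norm h * ((\<integral>\<^sup>+\<omega>. ?D i \<omega> \<partial>M) * ennreal (prob {\<omega> \<in> space M. U \<omega> \<ge> i})) \<partial>count_space {1..})"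
  proof (rule nn_integral_cong)
    fix i :: nat assume "i \<in> space (count_space {1..})"
    then have i: "i \<ge> 1" by simp
    note comp = measurable_seq_space_component[OF i]
    note [measurable] = XY_meas[OF i] measurable_compose[OF measurable_fst comp] measurable_compose[OF measurable_snd comp]
    have "(\<integral>\<^sup>+\<omega>. ?D i \<omega> * indicator {i..} (U \<omega>) \<partial>M)
        = (\<integral>\<^sup>+\<omega>. (case (rseq X \<omega>, rseq Y \<omega>) of (x, y) \<Rightarrow> ennreal \<bar>x i - y i\<bar> * indicator {i..} (U \<omega>)) \<partial>M)"
      by (simp add: seq[OF i])
    \<comment> \<open>The index is separated from the pair of sequences as a whole, which keeps
      their mutual coupling intact in the inner integral.\<close>
    also have "\<dots> = (\<integral>\<^sup>+\<omega>. (\<integral>\<^sup>+\<omega>'. (case (rseq X \<omega>', rseq Y \<omega>') of (x, y) \<Rightarrow>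
        ennreal \<bar>x i - y i\<bar> * indicator {i..} (U \<omega>)) \<partial>M) \<partial>M)"
      by (rule indep_rv_nn_integral[OF ind], rule measurable_pair_measure_countable1) (simp_all add: case_prod_beta)
    also have "\<dots> = (\<integral>\<^sup>+\<omega>. (\<integral>\<^sup>+\<omega>'. ?D i \<omega>' \<partial>M) * indicator {i..} (U \<omega>) \<partial>M)"
      by (simp add: seq[OF i] nn_integral_multc)
    also have "\<dots> = (\<integral>\<^sup>+\<omega>'. ?D i \<omega>' \<partial>M) * (\<integral>\<^sup>+\<omega>. indicator {\<omega> \<in> space M. U \<omega> \<ge> i} \<omega> \<partial>M)"
      by (subst nn_integral_cmult[symmetric]) (auto intro!: nn_integral_cong simp: indicator_def)
    finally show "(\<integral>\<^sup>+\<omega>. deriv_norm h * (?D i \<omega> * indicator {i..} (U \<omega>)) \<partial>M)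
        = deriv_norm h * ((\<integral>\<^sup>+\<omega>. ?D i \<omega> \<partial>M) * ennreal (prob {\<omega> \<in> space M. U \<omega> \<ge> i}))"
      by (simp add: emeasure_eq_measure nn_integral_cmult)
  qed
  finally show ?thesis by (simp add: ennreal_infsum_eq_nn_integral nn_integral_cmult)
qed

text \<open>Here \<open>M\<close> is the probability space and \<open>K\<close> is the other index.
  Averaging over the sequence first replaces each random extremum by \<open>e\<close> at its index.
  The difference of the two values of \<open>e\<close> is then split according to the joint value of
  \<open>(K, N)\<close>, and only there does the coupling of the indices enter.\<close>

lemma random_extremum_index_bound:
  fixes K N :: "'a \<Rightarrow> nat" and X :: "nat \<Rightarrow> 'a \<Rightarrow> real" and h :: "real \<Rightarrow> real" and \<alpha> :: int
  defines "e \<equiv> \<lambda>n. \<integral>\<omega>. h (W \<alpha> n (rseq X \<omega>)) \<partial>M"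
  assumes ind: "indep_rv M (count_space UNIV) K seq_space (rseq X)" "indep_rv M (count_space UNIV) N seq_space (rseq X)"
    and ge: "\<And>\<omega>. \<omega> \<in> space M \<Longrightarrow> K \<omega> \<ge> 1" "\<And>\<omega>. \<omega> \<in> space M \<Longrightarrow> N \<omega> \<ge> 1"
    and pos: "\<And>i \<omega>. \<omega> \<in> space M \<Longrightarrow> i \<ge> 1 \<Longrightarrow> rseq X \<omega> i > 0"
    and h: "continuous_on {0<..} h" "\<And>x. x > 0 \<Longrightarrow> \<bar>h x\<bar> \<le> B"
  shows "ennreal \<bar>(\<integral>\<omega>. h (W \<alpha> (N \<omega>) (rseq X \<omega>)) \<partial>M) - (\<integral>\<omega>. h (W \<alpha> (K \<omega>) (rseq X \<omega>)) \<partial>M)\<bar>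
    \<le> (\<Sum>\<^sub>\<infinity>(m, n)\<in>{1..} \<times> {1..}. ennreal (prob {\<omega> \<in> space M. K \<omega> = m \<and> N \<omega> = n} * \<bar>e n - e m\<bar>))"
proof -
  have [measurable]: "K \<in> measurable M (count_space UNIV)" "N \<in> measurable M (count_space UNIV)"
    "rseq X \<in> measurable M seq_space"
    using ind by (auto simp: indep_rv_def)
  obtain F where F_meas[measurable]: "case_prod F \<in> borel_measurable (count_space UNIV \<Otimes>\<^sub>M seq_space)"
    and F: "\<And>n x. \<bar>F n x\<bar> \<le> B" "\<And>n x. n \<ge> 1 \<Longrightarrow> (\<And>i. i \<ge> 1 \<Longrightarrow> x i > 0) \<Longrightarrow> F n x = h (W \<alpha> n x)"
    using obtain_measurable_extremum_function[OF h] by metis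
  have [measurable]: "F n \<in> borel_measurable seq_space" for n
    using measurable_compose[OF measurable_Pair1' F_meas, of n] by simp
  \<comment> \<open>At index 0 the value of \<open>e\<close> rests on an unspecified extremum.
    \<open>e'\<close> equals \<open>e\<close> from 1 on and obeys the bound \<open>B\<close> at
    every index, which makes its composition with an index integrable.\<close>
  define e' where "e' n = (\<integral>\<omega>. F n (rseq X \<omega>) \<partial>M)" for n
  have e': "e' n = e n" if "n \<ge> 1" for n
    unfolding e_def e'_def using that pos by (intro Bochner_Integration.integral_cong refl F(2)) auto
  have "B \<ge> 0" using F(1)[of undefined undefined] by linarith
  have "\<bar>e' n\<bar> \<le> B" for n
  proof -
    have "norm (e' n) \<le> (\<integral>\<omega>. norm (F n (rseq X \<omega>)) \<partial>M)"
      unfolding e'_def by (rule integral_norm_bound)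
    also have "\<dots> \<le> (\<integral>\<omega>. B \<partial>M)"
      using F(1) by (intro integral_mono integrable_const_bound[of _ B]) (auto simp: \<open>B \<ge> 0\<close>)
    finally show ?thesis by (simp add: prob_space)
  qed
  moreover have "(\<lambda>\<omega>. e' (N \<omega>)) \<in> borel_measurable M" "(\<lambda>\<omega>. e' (K \<omega>)) \<in> borel_measurable M"
    by (rule measurable_compose[where N="count_space UNIV"]; simp)+
  ultimately have int: "integrable M (\<lambda>\<omega>. e' (N \<omega>))" "integrable M (\<lambda>\<omega>. e' (K \<omega>))"
    by (auto intro!: integrable_const_bound[of _ B])
  have mean: "(\<integral>\<omega>. h (W \<alpha> (U \<omega>) (rseq X \<omega>)) \<partial>M) = (\<integral>\<omega>. e' (U \<omega>) \<partial>M)"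
    if "indep_rv M (count_space UNIV) U seq_space (rseq X)" "\<And>\<omega>. \<omega> \<in> space M \<Longrightarrow> U \<omega> \<ge> 1" for U
  proof -
    have "(\<integral>\<omega>. h (W \<alpha> (U \<omega>) (rseq X \<omega>)) \<partial>M) = (\<integral>\<omega>. F (U \<omega>) (rseq X \<omega>) \<partial>M)"
      using that(2) pos by (intro Bochner_Integration.integral_cong refl F(2)[symmetric]) auto
    also have "\<dots> = (\<integral>\<omega>. e' (U \<omega>) \<partial>M)"
      unfolding e'_def by (rule indep_rv_integral[OF that(1) F_meas F(1)])
    finally show ?thesis .
  qed
  have "ennreal \<bar>(\<integral>\<omega>. h (W \<alpha> (N \<omega>) (rseq X \<omega>)) \<partial>M) - (\<integral>\<omega>. h (W \<alpha> (K \<omega>) (rseq X \<omega>)) \<partial>M)\<bar>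
      = ennreal (norm (\<integral>\<omega>. e' (N \<omega>) - e' (K \<omega>) \<partial>M))"
    using int by (simp add: mean[OF ind(1) ge(1)] mean[OF ind(2) ge(2)])
  also have "\<dots> \<le> (\<integral>\<^sup>+\<omega>. ennreal \<bar>e' (N \<omega>) - e' (K \<omega>)\<bar> \<partial>M)"
    using integral_norm_bound_ennreal[OF Bochner_Integration.integrable_diff[OF int]] by simp
  also have "\<dots> = (\<integral>\<^sup>+\<omega>. (\<integral>\<^sup>+(m, n). ennreal \<bar>e n - e m\<bar> * indicator {\<omega> \<in> space M. K \<omega> = m \<and> N \<omega> = n} \<omega>
      \<partial>count_space ({1..} \<times> {1..})) \<partial>M)"
  proof (rule nn_integral_cong)
    fix \<omega> assume \<omega>: "\<omega> \<in> space M"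
    \<comment> \<open>For a fixed sample point the only pair with nonzero indicator is
      \<open>(K \<omega>, N \<omega>)\<close>.\<close>
    have "(\<integral>\<^sup>+(m, n). ennreal \<bar>e n - e m\<bar> * indicator {\<omega> \<in> space M. K \<omega> = m \<and> N \<omega> = n} \<omega>
        \<partial>count_space ({1..} \<times> {1..}))
      = (\<Sum>(m, n)\<in>{(K \<omega>, N \<omega>)}. ennreal \<bar>e n - e m\<bar> * indicator {\<omega> \<in> space M. K \<omega> = m \<and> N \<omega> = n} \<omega>)"
      using ge[OF \<omega>] by (intro nn_integral_count_space') (auto simp: indicator_def split: if_splits)
    then show "ennreal \<bar>e' (N \<omega>) - e' (K \<omega>)\<bar>
      = (\<integral>\<^sup>+(m, n). ennreal \<bar>e n - e m\<bar> * indicator {\<omega> \<in> space M. K \<omega> = m \<and> N \<omega> = n} \<omega>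
        \<partial>count_space ({1..} \<times> {1..}))"
      using \<omega> ge[OF \<omega>] by (simp add: e')
  qed
  also have "\<dots> = (\<integral>\<^sup>+z. (\<integral>\<^sup>+\<omega>. (case z of (m, n) \<Rightarrow>
      ennreal \<bar>e n - e m\<bar> * indicator {\<omega> \<in> space M. K \<omega> = m \<and> N \<omega> = n} \<omega>) \<partial>M) \<partial>count_space ({1..} \<times> {1..}))"
    by (rule nn_integral_count_space_nn_integral) (auto simp: case_prod_beta)
  also have "\<dots> = (\<integral>\<^sup>+(m, n). ennreal (prob {\<omega> \<in> space M. K \<omega> = m \<and> N \<omega> = n} * \<bar>e n - e m\<bar>)
      \<partial>count_space ({1..} \<times> {1..}))"
    by (intro nn_integral_cong)
      (auto simp: nn_integral_cmult_indicator emeasure_eq_measure ennreal_mult mult.commute)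
  finally show ?thesis by (simp add: ennreal_infsum_eq_nn_integral)
qed

end

text \<open>An event of \<open>V\<close> is an event of the pair, with the whole space as second
  side of the rectangle. This supplies the independence of \<open>M\<close> and \<open>E\<close>,
  which are linked only through the joint hypothesis.\<close>

lemma (in prob_space) indep_rv_fst:
  assumes "indep_rv M S U (T \<Otimes>\<^sub>M T') (\<lambda>\<omega>. (V \<omega>, V' \<omega>))"
  shows "indep_rv M S U T V"
proof -
  have U: "U \<in> measurable M S" and VV: "(\<lambda>\<omega>. (V \<omega>, V' \<omega>)) \<in> measurable M (T \<Otimes>\<^sub>M T')"
    and ind: "indep_set {U -` A \<inter> space M | A. A \<in> sets S}
      {(\<lambda>\<omega>. (V \<omega>, V' \<omega>)) -` B \<inter> space M | B. B \<in> sets (T \<Otimes>\<^sub>M T')}"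
    using assms by (auto simp: indep_rv_def)
  have V: "V \<in> measurable M T" using measurable_compose[OF VV measurable_fst] by simp
  have vimage: "V -` B \<inter> space M = (\<lambda>\<omega>. (V \<omega>, V' \<omega>)) -` (B \<times> space T') \<inter> space M" for B
    using measurable_space[OF VV] by (auto simp: space_pair_measure)
  have "indep_set {U -` A \<inter> space M | A. A \<in> sets S} {V -` B \<inter> space M | B. B \<in> sets T}"
  proof (rule indep_setI)
    fix a b assume "a \<in> {U -` A \<inter> space M | A. A \<in> sets S}" "b \<in> {V -` B \<inter> space M | B. B \<in> sets T}"
    then show "prob (a \<inter> b) = prob a * prob b"
      using vimage by (intro indep_setD[OF ind]) (blast intro: pair_measureI sets.top)+
  qed (use U V in \<open>auto intro: measurable_sets\<close>)
  with U V show ?thesis by (simp add: indep_rv_def)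
qed

theorem proposition3p3:
  fixes P :: "'a measure"
    and M N :: "'a \<Rightarrow> nat"
    and E X :: "nat \<Rightarrow> 'a \<Rightarrow> real"
    and \<alpha> :: int
    and h :: "real \<Rightarrow> real"
  assumes "prob_space P"
    and "\<alpha> \<in> {-1, 1}"
    and "CCR P M X"
    and "CCR P N E"
    and "indep_rv P (count_space UNIV) M
           (seq_space \<Otimes>\<^sub>M seq_space) (\<lambda>\<omega>. (rseq E \<omega>, rseq X \<omega>))"
    and "indep_rv P (count_space UNIV) N
           (seq_space \<Otimes>\<^sub>M seq_space) (\<lambda>\<omega>. (rseq E \<omega>, rseq X \<omega>))"
    and "h \<in> Lip_b1"
  shows "ennreal \<bar>(\<integral>\<omega>. h (W \<alpha> (N \<omega>) (rseq E \<omega>)) \<partial>P) - (\<integral>\<omega>. h (W \<alpha> (M \<omega>) (rseq X \<omega>)) \<partial>P)\<bar>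
           \<le> deriv_norm h *
               (\<Sum>\<^sub>\<infinity>i\<in>{1..}. (\<integral>\<^sup>+\<omega>. ennreal \<bar>E i \<omega> - X i \<omega>\<bar> \<partial>P) * ennreal \<P>(\<omega> in P. M \<omega> \<ge> i))
             + (\<Sum>\<^sub>\<infinity>(m, n)\<in>{1..} \<times> {1..}. ennreal (\<P>(\<omega> in P. M \<omega> = m \<and> N \<omega> = n) *
                 \<bar>(\<integral>\<omega>. h (W \<alpha> n (rseq E \<omega>)) \<partial>P) - (\<integral>\<omega>. h (W \<alpha> m (rseq E \<omega>)) \<partial>P)\<bar>))
         \<and> (distr P (count_space UNIV) M = distr P (count_space UNIV) N \<longrightarrow>
            ennreal \<bar>(\<integral>\<omega>. h (W \<alpha> (N \<omega>) (rseq E \<omega>)) \<partial>P) - (\<integral>\<omega>. h (W \<alpha> (N \<omega>) (rseq X \<omega>)) \<partial>P)\<bar>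
              \<le> deriv_norm h *
                  (\<Sum>\<^sub>\<infinity>i\<in>{1..}. (\<integral>\<^sup>+\<omega>. ennreal \<bar>E i \<omega> - X i \<omega>\<bar> \<partial>P) * ennreal \<P>(\<omega> in P. N \<omega> \<ge> i)))"
proof -
  interpret prob_space P by fact
  have lip: "1-lipschitz_on {0<..} h" using assms(7) by (simp add: Lip_b1_def)
  have bounded: "\<bar>h x\<bar> \<le> 1" if "x > 0" for x
  proof -
    have "ennreal \<bar>h x\<bar> \<le> sup_norm h"
      unfolding sup_norm_def using that by (intro SUP_upper) auto
    also have "\<dots> \<le> ennreal 1" using assms(7) by (simp add: Lip_b1_def)
    finally show ?thesis by (subst (asm) ennreal_le_iff) auto
  qed
  have ge: "\<And>\<omega>. \<omega> \<in> space P \<Longrightarrow> M \<omega> \<ge> 1" "\<And>\<omega>. \<omega> \<in> space P \<Longrightarrow> N \<omega> \<ge> 1"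
    and iid: "positive_iid P X" "positive_iid P E"
    using assms(3,4) by (auto simp: CCR_def)
  \<comment> \<open>\<open>E\<close> is the first and \<open>X\<close> the second sequence of the
    coupling bound, hence this order.\<close>
  note pos = rseq_pos[OF iid(2)] rseq_pos[OF iid(1)]
  note coupling = random_extremum_coupling_bound[OF _ _ pos lip bounded, of _ \<alpha>]
  note index = random_extremum_index_bound[OF assms(5,6)[THEN indep_rv_fst] ge pos(1)
      lipschitz_on_continuous_on[OF lip] bounded, of \<alpha>]
  have "\<bar>(\<integral>\<omega>. h (W \<alpha> (N \<omega>) (rseq E \<omega>)) \<partial>P) - (\<integral>\<omega>. h (W \<alpha> (M \<omega>) (rseq X \<omega>)) \<partial>P)\<bar>
    \<le> \<bar>(\<integral>\<omega>. h (W \<alpha> (M \<omega>) (rseq E \<omega>)) \<partial>P) - (\<integral>\<omega>. h (W \<alpha> (M \<omega>) (rseq X \<omega>)) \<partial>P)\<bar>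
      + \<bar>(\<integral>\<omega>. h (W \<alpha> (N \<omega>) (rseq E \<omega>)) \<partial>P) - (\<integral>\<omega>. h (W \<alpha> (M \<omega>) (rseq E \<omega>)) \<partial>P)\<bar>"
    by linarith
  then have "ennreal \<bar>(\<integral>\<omega>. h (W \<alpha> (N \<omega>) (rseq E \<omega>)) \<partial>P) - (\<integral>\<omega>. h (W \<alpha> (M \<omega>) (rseq X \<omega>)) \<partial>P)\<bar>
    \<le> ennreal \<bar>(\<integral>\<omega>. h (W \<alpha> (M \<omega>) (rseq E \<omega>)) \<partial>P) - (\<integral>\<omega>. h (W \<alpha> (M \<omega>) (rseq X \<omega>)) \<partial>P)\<bar>
      + ennreal \<bar>(\<integral>\<omega>. h (W \<alpha> (N \<omega>) (rseq E \<omega>)) \<partial>P) - (\<integral>\<omega>. h (W \<alpha> (M \<omega>) (rseq E \<omega>)) \<partial>P)\<bar>"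
    by (simp add: ennreal_plus[symmetric] ennreal_leI del: ennreal_plus)
  also have "\<dots> \<le> deriv_norm h *
        (\<Sum>\<^sub>\<infinity>i\<in>{1..}. (\<integral>\<^sup>+\<omega>. ennreal \<bar>E i \<omega> - X i \<omega>\<bar> \<partial>P) * ennreal \<P>(\<omega> in P. M \<omega> \<ge> i))
      + (\<Sum>\<^sub>\<infinity>(m, n)\<in>{1..} \<times> {1..}. ennreal (\<P>(\<omega> in P. M \<omega> = m \<and> N \<omega> = n) *
          \<bar>(\<integral>\<omega>. h (W \<alpha> n (rseq E \<omega>)) \<partial>P) - (\<integral>\<omega>. h (W \<alpha> m (rseq E \<omega>)) \<partial>P)\<bar>))"
    by (rule add_mono[OF coupling[OF assms(5) ge(1)] index])
  \<comment> \<open>Both means in the second inequality carry the index \<open>N\<close>, so it is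
    the coupling bound taken at \<open>N\<close>.\<close>
  finally show ?thesis using coupling[OF assms(6) ge(2)] by simp
qed

end
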